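(* For every $f\ge0$, $$F_{1,f}(t)=2(2f+1)\,t(1+t)^f+8\binom f2\,t^2(1+t)^{f-2}.$$
   Context: Terms with vanishing binomial coefficient are $0$ (so for $f<2$ the second term is absent). For $n\ge1$, $\mathfrak B_n$ is the hyperoctahedral group of signed permutations: words $\pi=\pi_1\cdots\pi_n$ of nonzero integers such that $|\pi_1|,\dots,|\pi_n|$ is a permutation of $[n]=\{1,\dots,n\}$, with $\pi(i)=\pi_i$, $\pi(-i)=-\pi(i)$. $\mathcal I_n^B$ is the set of $\pi\in\mathfrak B_n$ with $\pi^2=\mathrm{id}$. With $\pi_0=0$ and the usual order on $\mathbb Z$, $\operatorname{des}^B(\pi)=\#\{0\le i\le n-1:\pi_i>\pi_{i+1}\}$. $\operatorname{fix}_B(\pi)=\#\{i\in[n]:|\pi(i)|=i\}$, and $\operatorname{cyc}_2(\pi)$ is the number of two-cycles of the ordinary involution $i\mapsto|\pi(i)|$ of $[n]$. The polynomial $F_{1,f}$ is the case $j=1$ of $$F_{j,f}(t)=\sum_{\substack{\pi\in\mathcal I_{2j+f}^B\\ \operatorname{cyc}_2(\pi)=j,\ \operatorname{fix}_B(\pi)=f}}t^{\operatorname{des}^B(\pi)}.$$ *)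

theory Defs
  imports Complex_Main "HOL-Computational_Algebra.Polynomial"
begin

text \<open>Signed permutations of \<open>[n]\<close> are words \<open>\<pi>\<^sub>1 \<dots> \<pi>\<^sub>n\<close>, represented as integer lists;
  the letter \<open>\<pi>\<^sub>i\<close> is the list entry with index \<open>i - 1\<close>.\<close>

definition signed_perms :: "nat \<Rightarrow> int list set" where
  "signed_perms n =
     {w. length w = n \<and> distinct (map abs w) \<and> set (map abs w) = {1..int n}}"

text \<open>The action on \<open>{-n..n}\<close>, with \<open>\<pi>(-i) = -\<pi>(i)\<close> and the convention \<open>\<pi>\<^sub>0 = 0\<close>.\<close>

definition sp_app :: "int list \<Rightarrow> int \<Rightarrow> int" where
  "sp_app w i =
     (if i > 0 then w ! (nat i - 1) else if i < 0 then - (w ! (nat (- i) - 1)) else 0)"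

definition signed_involutions :: "nat \<Rightarrow> int list set" where
  "signed_involutions n =
     {w \<in> signed_perms n. \<forall>i\<in>{- int n..int n}. sp_app w (sp_app w i) = i}"

definition desB :: "int list \<Rightarrow> nat" where
  "desB w = card {i \<in> {0..int (length w) - 1}. sp_app w i > sp_app w (i + 1)}"

definition fixB :: "int list \<Rightarrow> nat" where
  "fixB w = card {i \<in> {1..int (length w)}. \<bar>sp_app w i\<bar> = i}"

definition cyc2 :: "int list \<Rightarrow> nat" where
  "cyc2 w = card {{i, k} | i k. i \<in> {1..int (length w)} \<and> k \<in> {1..int (length w)} \<and>
                     i \<noteq> k \<and> \<bar>sp_app w i\<bar> = k \<and> \<bar>sp_app w k\<bar> = i}"

definition Fpoly :: "nat \<Rightarrow> nat \<Rightarrow> int poly" where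
  "Fpoly j f = (\<Sum>w \<in> {w \<in> signed_involutions (2 * j + f). cyc2 w = j \<and> fixB w = f}.
                  monom 1 (desB w))"

lemma finite_signed_perms: "finite (signed_perms n)"
proof (rule finite_subset)
  show "signed_perms n \<subseteq> {w. set w \<subseteq> {- int n..int n} \<and> length w = n}"
    unfolding signed_perms_def by force
  show "finite {w. set w \<subseteq> {- int n..int n} \<and> length w = n}"
    by (rule finite_lists_length_eq) simp
qed

end

theory Submission
  imports Defs
begin

text \<open>An involution with a single two-cycle is determined by the positions \<open>a < b\<close> of the cycle, the
  common sign \<open>e\<close> of its two letters and the set \<open>S\<close> of negative fixed positions. Away from the
  cycle there is a descent into position \<open>k\<close> iff \<open>k \<in> S\<close>. Near the cycle there is always one descent
  at \<open>a\<close> or \<open>a + 1\<close> (according to \<open>e\<close>), the sign at \<open>a + 1\<close> does not affect the descent into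
  \<open>a + 1\<close>, and for \<open>b > a + 1\<close> the descent into \<open>b\<close> occurs iff \<open>b - 1 \<notin> S\<close>. Summing over \<open>S\<close> thus
  factorises: it gives \<open>t (1 + t)\<^sup>f\<close> if \<open>b - a \<le> 2\<close>, and \<open>t \<cdot> 2 \<cdot> 2t (1 + t)\<^bsup>f - 2\<^esup>\<close> otherwise.\<close>

text \<open>Positions are counted from \<open>0\<close>, so position \<open>k\<close> carries the absolute value \<open>k + 1\<close> when fixed.\<close>

definition inv_word :: "nat \<Rightarrow> nat \<Rightarrow> nat \<Rightarrow> int \<Rightarrow> nat set \<Rightarrow> int list" where
  "inv_word n a b e S =
     map (\<lambda>k. if k = a then e * (int b + 1) else if k = b then e * (int a + 1)
              else if k \<in> S then - (int k + 1) else int k + 1) [0..<n]"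

lemma length_inv_word [simp]: "length (inv_word n a b e S) = n"
  by (simp add: inv_word_def)

lemma nth_inv_word [simp]:
  "k < n \<Longrightarrow> inv_word n a b e S ! k =
     (if k = a then e * (int b + 1) else if k = b then e * (int a + 1)
      else if k \<in> S then - (int k + 1) else int k + 1)"
  by (simp add: inv_word_def)

section \<open>Translation from signed positions to list indices\<close>

lemma sp_app_Suc: "sp_app w (int k + 1) = w ! k"
  by (simp add: sp_app_def nat_add_distrib)

lemma sp_app_minus: "sp_app w (- i) = - sp_app w i"
  by (simp add: sp_app_def)

lemma nat_index:
  assumes "i \<in> {1..int n}"
  obtains k where "k < n" "i = int k + 1"
  using assms by (intro that[of "nat (i - 1)"]) auto

lemma atLeastAtMost_int_eq_image: "{1..int n} = (\<lambda>k. int k + 1) ` {..<n}"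
  by (auto elim!: nat_index)

text \<open>A descent is recorded by the list index of its right-hand letter: the letter
  \<open>w ! k\<close> stands at signed position \<open>k + 1\<close>, so its left neighbour is
  \<open>sp_app w (int k)\<close>, which is the convention value 0 for \<open>k = 0\<close>.\<close>

lemma desB_eq: "desB w = card {k. k < length w \<and> sp_app w (int k) > w ! k}"
proof -
  have "{i \<in> {0..int (length w) - 1}. sp_app w i > sp_app w (i + 1)}
        = int ` {k. k < length w \<and> sp_app w (int k) > w ! k}" (is "?A = int ` ?B")
  proof
    show "?A \<subseteq> int ` ?B"
    proof
      fix i assume i: "i \<in> ?A"
      then have "i = int (nat i)" "nat i < length w" by auto
      with i show "i \<in> int ` ?B"
        by (intro image_eqI[of _ _ "nat i"]) (auto simp: sp_app_Suc[symmetric])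
    qed
  qed (auto simp: sp_app_Suc)
  then show ?thesis
    by (simp add: desB_def card_image)
qed

section \<open>Descents of the parametrised words and their generating function over sign
  sets\<close>

lemma sp_app_int: "sp_app w (int k) = (if k = 0 then 0 else w ! (k - 1))"
  by (simp add: sp_app_def)

text \<open>In each comparison the letter of larger absolute value decides. At \<open>a\<close> and
  \<open>a + 1\<close> this is \<open>e * (b + 1)\<close>; at \<open>b > a + 1\<close> it is the
  preceding fixed letter, of absolute value \<open>b\<close>; elsewhere it is the letter
  \<open>k + 1\<close> or \<open>- (k + 1)\<close> itself.\<close>

lemma desB_inv_word:
  assumes "a < b" "b < n" "e \<in> {1, -1}" "S \<subseteq> {..<n} - {a, b}"
  shows "desB (inv_word n a b e S)
           = Suc (card (S - {Suc a}) + of_bool (b \<noteq> Suc a \<and> b - 1 \<notin> S))"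
proof -
  \<comment> \<open>The one descent forced by the cycle: a large positive letter at \<open>a\<close>
    drops into \<open>a + 1\<close>, a large negative one is dropped into at
    \<open>a\<close>.\<close>
  define c where "c = (if e = 1 then Suc a else a)"
  define B where "B = (if b \<noteq> Suc a \<and> b - 1 \<notin> S then {b} else {})"
  have "finite S" using assms(4) finite_subset by blast
  have "{k. k < n \<and> sp_app (inv_word n a b e S) (int k) > inv_word n a b e S ! k}
        = insert c ((S - {Suc a}) \<union> B)"
  proof (rule set_eqI)
    fix k
    show "k \<in> {k. k < n \<and> sp_app (inv_word n a b e S) (int k) > inv_word n a b e S ! k}
        \<longleftrightarrow> k \<in> insert c ((S - {Suc a}) \<union> B)"
    proof (cases "k < n")
      case False
      then show ?thesis using assms by (auto simp: c_def B_def)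
    next
      case True
      consider "k = a" | "k = Suc a" | "k = b" "k \<noteq> Suc a" | "k \<noteq> a" "k \<noteq> Suc a" "k \<noteq> b"
        by blast
      then show ?thesis
      proof cases
        case 1
        with True assms show ?thesis by (auto simp: sp_app_int c_def B_def)
      next
        case 2
        with True assms show ?thesis by (auto simp: sp_app_int c_def B_def)
      next
        case 3
        with assms have "b - 1 < n" "b - 1 \<noteq> a" "b - 1 \<noteq> b" "b \<noteq> 0" "b \<notin> S" "b \<noteq> a" by auto
        with 3 assms(1-3) show ?thesis by (auto simp: sp_app_int c_def B_def)
      next
        case 4
        \<comment> \<open>The preceding letter is not the one at \<open>a\<close>, so it is fixed
          with absolute value \<open>k\<close>, or is the letter at \<open>b\<close> with absolute
          value \<open>a + 1\<close>, or is the initial 0.\<close>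
        then have "\<bar>sp_app (inv_word n a b e S) (int k)\<bar> \<le> int k"
          using True assms(1-3) by (auto simp: sp_app_int)
        then have "sp_app (inv_word n a b e S) (int k) > inv_word n a b e S ! k \<longleftrightarrow> k \<in> S"
          using 4 True by auto
        with 4 True show ?thesis by (simp add: c_def B_def)
      qed
    qed
  qed
  moreover have "c \<notin> (S - {Suc a}) \<union> B" "(S - {Suc a}) \<inter> B = {}"
    using assms by (auto simp: c_def B_def)
  moreover have "card B = of_bool (b \<noteq> Suc a \<and> b - 1 \<notin> S)" "finite B"
    by (auto simp: B_def)
  ultimately show ?thesis
    using \<open>finite S\<close> by (simp add: desB_eq card_Un_disjoint)
qed

lemma sum_Pow_prod:
  fixes x y :: "'a \<Rightarrow> 'b::comm_semiring_1"
  assumes "finite F"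
  shows "(\<Sum>S\<in>Pow F. (\<Prod>k\<in>S. x k) * (\<Prod>k\<in>F - S. y k)) = (\<Prod>k\<in>F. x k + y k)"
  using prod_add[OF assms, of x y] by simp

text \<open>By the descent formula the weight of \<open>S\<close> is \<open>t\<close> times a
  product over free positions, so each position contributes an independent factor. Only
  \<open>a + 1\<close> and \<open>b - 1\<close> can have a factor other than
  \<open>1 + t\<close>.\<close>

lemma sum_desB_inv_word:
  assumes "a < b" "b < f + 2" "e \<in> {1, -1}"
  defines "t \<equiv> (monom 1 1 :: int poly)"
  shows "(\<Sum>S\<in>Pow ({..<f + 2} - {a, b}). monom 1 (desB (inv_word (f + 2) a b e S)))
           = (if b \<le> a + 2 then t * (1 + t) ^ f else 4 * t ^ 2 * (1 + t) ^ (f - 2))"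
proof -
  define F where "F = {..<f + 2} - {a, b}"
  \<comment> \<open>\<open>x k\<close> and \<open>y k\<close> are the weights of a negative, resp. positive, letter at \<open>k\<close>.\<close>
  define x where "x k = (if k = Suc a then 1 else t)" for k
  define y where "y k = (if k = b - 1 then t else 1)" for k
  have F: "finite F" "card F = f"
    using assms by (auto simp: F_def card_Diff_subset)
  have monom_t: "monom 1 m = t ^ m" for m
    by (simp add: t_def monom_power)
  have *: "monom 1 (desB (inv_word (f + 2) a b e S))
           = t * ((\<Prod>k\<in>S. x k) * (\<Prod>k\<in>F - S. y k))" if "S \<in> Pow F" for S
  proof -
    have "finite S" using that F finite_subset by auto
    have "(\<Prod>k\<in>S. x k) = (\<Prod>k\<in>S - {Suc a}. t)"
      by (rule prod.mono_neutral_cong_right) (use \<open>finite S\<close> in \<open>auto simp: x_def\<close>)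
    then have 1: "(\<Prod>k\<in>S. x k) = t ^ card (S - {Suc a})" by simp
    \<comment> \<open>If \<open>b = a + 1\<close>, then \<open>b - 1\<close> is the excluded
      position \<open>a\<close>.\<close>
    have "b - 1 \<in> F - S \<longleftrightarrow> b \<noteq> Suc a \<and> b - 1 \<notin> S"
      using assms by (auto simp: F_def)
    then have 2: "(\<Prod>k\<in>F - S. y k) = t ^ of_bool (b \<noteq> Suc a \<and> b - 1 \<notin> S)"
      using F by (auto simp: y_def)
    have "desB (inv_word (f + 2) a b e S)
           = Suc (card (S - {Suc a}) + of_bool (b \<noteq> Suc a \<and> b - 1 \<notin> S))"
      using assms that by (intro desB_inv_word) (auto simp: F_def)
    then show ?thesis
      unfolding monom_t 1 2 by (simp only: power_Suc power_add)
  qed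
  have "(\<Sum>S\<in>Pow F. monom 1 (desB (inv_word (f + 2) a b e S)))
        = (\<Sum>S\<in>Pow F. t * ((\<Prod>k\<in>S. x k) * (\<Prod>k\<in>F - S. y k)))"
    by (intro sum.cong refl *)
  also have "\<dots> = t * (\<Prod>k\<in>F. x k + y k)"
    unfolding sum_distrib_left[symmetric] sum_Pow_prod[OF F(1)] ..
  also have "\<dots> = (if b \<le> a + 2 then t * (1 + t) ^ f else 4 * t ^ 2 * (1 + t) ^ (f - 2))"
  proof (cases "b \<le> a + 2")
    case True
    \<comment> \<open>For \<open>b = a + 1\<close> both exceptional positions lie outside
      \<open>F\<close>; for \<open>b = a + 2\<close> they coincide, and the factor there is again
      \<open>1 + t\<close>.\<close>
    have "(\<Prod>k\<in>F. x k + y k) = (\<Prod>k\<in>F. 1 + t)"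
      using True assms by (intro prod.cong) (auto simp: x_def y_def F_def)
    with True F show ?thesis by simp
  next
    case False
    define G where "G = F - {Suc a, b - 1}"
    \<comment> \<open>Now the exceptional positions are distinct: \<open>a + 1\<close> contributes
      \<open>1 + 1\<close> and \<open>b - 1\<close> contributes \<open>t + t\<close>.\<close>
    have "F = insert (Suc a) (insert (b - 1) G)" "Suc a \<notin> insert (b - 1) G" "b - 1 \<notin> G" "finite G"
      using False assms F by (auto simp: F_def G_def)
    moreover from this have "card G = f - 2" using F by auto
    moreover have "(\<Prod>k\<in>G. x k + y k) = (\<Prod>k\<in>G. 1 + t)"
      by (intro prod.cong) (auto simp: x_def y_def G_def)
    ultimately have "(\<Prod>k\<in>F. x k + y k) = (1 + 1) * ((t + t) * (1 + t) ^ (f - 2))"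
      using False by (simp add: x_def y_def)
    with False show ?thesis by (simp add: power2_eq_square)
  qed
  finally show ?thesis by (simp add: F_def)
qed

section \<open>The words are involutions with exactly one two-cycle\<close>

lemma inv_word_in_signed_involutions:
  assumes "a < b" "b < n" "e \<in> {1, -1}"
  shows "inv_word n a b e S \<in> signed_involutions n"
proof -
  let ?w = "inv_word n a b e S"
  \<comment> \<open>The transposition of \<open>a\<close> and \<open>b\<close> underlying the
    word.\<close>
  define s where "s k = (if k = a then b else if k = b then a else k)" for k
  have ab: "\<bar>?w ! k\<bar> = int (s k) + 1" if "k < n" for k
    using assms that by (auto simp: s_def)
  have s: "s k < n \<longleftrightarrow> k < n" "s (s k) = k" for k
    using assms by (auto simp: s_def)
  have mp: "map abs ?w = map (\<lambda>k. int (s k) + 1) [0..<n]"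
    by (rule nth_equalityI) (auto simp: ab simp del: nth_inv_word)
  have "inj s" by (metis s(2) injI)
  then have "distinct (map abs ?w)"
    unfolding mp by (auto simp: distinct_map inj_on_def)
  moreover have "set (map abs ?w) = {1..int n}"
  proof -
    have "s ` {..<n} = {..<n}" using s by (metis (no_types, lifting) image_eqI lessThan_iff image_subsetI subsetI subset_antisym)
    then show ?thesis unfolding mp atLeastAtMost_int_eq_image
      by (simp add: atLeast0LessThan image_image[symmetric, of "\<lambda>k. int k + 1" s])
  qed
  moreover have "sp_app ?w (sp_app ?w i) = i" if i: "i \<in> {- int n..int n}" for i
  proof -
    have pos: "sp_app ?w (sp_app ?w (int k + 1)) = int k + 1" if "k < n" for k
    proof -
      have *: "sp_app ?w (- (int k + 1)) = - (?w ! k)" for k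
        unfolding sp_app_minus sp_app_Suc ..
      show ?thesis
        using assms that sp_app_Suc[of ?w] *[of k] *[of a] *[of b]
        by (auto simp: sp_app_Suc)
    qed
    consider "i = 0" | "i \<in> {1..int n}" | "- i \<in> {1..int n}" using i by force
    then show ?thesis
    proof cases
      case 1 then show ?thesis by (simp add: sp_app_def)
    next
      case 2
      then obtain k where "k < n" "i = int k + 1" by (rule nat_index)
      then show ?thesis using pos by simp
    next
      case 3
      then obtain k where "k < n" "- i = int k + 1" by (rule nat_index)
      then have "sp_app ?w (sp_app ?w (- i)) = - i" using pos by simp
      then show ?thesis by (simp add: sp_app_minus)
    qed
  qed
  ultimately show ?thesis
    by (auto simp: signed_involutions_def signed_perms_def)
qed

lemma fixB_eq: "fixB w = card {k. k < length w \<and> \<bar>w ! k\<bar> = int k + 1}"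
proof -
  have "{i \<in> {1..int (length w)}. \<bar>sp_app w i\<bar> = i}
        = (\<lambda>k. int k + 1) ` {k. k < length w \<and> \<bar>w ! k\<bar> = int k + 1}"
    unfolding atLeastAtMost_int_eq_image by (auto simp: sp_app_Suc)
  then show ?thesis by (simp add: fixB_def card_image inj_on_def)
qed

text \<open>A two-cycle is an unordered pair, so its elements may be sorted; shifting positions by
  one is injective on sets and keeps the count.\<close>

lemma cyc2_eq:
  "cyc2 w = card {{i, k} | i k. i < k \<and> k < length w \<and>
                    \<bar>w ! i\<bar> = int k + 1 \<and> \<bar>w ! k\<bar> = int i + 1}"
proof -
  let ?g = "\<lambda>k. int k + 1"
  let ?B = "{{i, k} | i k. i < k \<and> k < length w \<and> \<bar>w ! i\<bar> = int k + 1 \<and> \<bar>w ! k\<bar> = int i + 1}"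
  have "{{i, k} | i k. i \<in> {1..int (length w)} \<and> k \<in> {1..int (length w)} \<and>
                     i \<noteq> k \<and> \<bar>sp_app w i\<bar> = k \<and> \<bar>sp_app w k\<bar> = i} = image ?g ` ?B" (is "?A = _")
  proof
    show "?A \<subseteq> image ?g ` ?B"
    proof clarify
      fix i k
      assume *: "i \<in> {1..int (length w)}" "\<bar>sp_app w i\<bar> \<in> {1..int (length w)}"
        "i \<noteq> \<bar>sp_app w i\<bar>" "\<bar>sp_app w \<bar>sp_app w i\<bar>\<bar> = i"
      obtain p where p: "p < length w" "i = int p + 1" using *(1) by (rule nat_index)
      obtain q where q: "q < length w" "\<bar>sp_app w i\<bar> = int q + 1" using *(2) by (rule nat_index)
      have h: "\<bar>w ! p\<bar> = int q + 1" "\<bar>w ! q\<bar> = int p + 1" "p \<noteq> q"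
        using * p q by (auto simp: sp_app_Suc)
      have "{p, q} \<in> ?B"
      proof (cases "p < q")
        case True
        then show ?thesis using h q by blast
      next
        case False
        then have "q < p" using h by simp
        then have "{q, p} \<in> ?B" using h p by blast
        then show ?thesis by (simp add: insert_commute)
      qed
      moreover have "{i, \<bar>sp_app w i\<bar>} = ?g ` {p, q}" using p q by simp
      ultimately show "{i, \<bar>sp_app w i\<bar>} \<in> image ?g ` ?B" by blast
    qed
    show "image ?g ` ?B \<subseteq> ?A"
    proof clarify
      fix i k :: nat
      assume "i < k" "k < length w" "\<bar>w ! i\<bar> = int k + 1" "\<bar>w ! k\<bar> = int i + 1"
      then show "\<exists>i' k'. ?g ` {i, k} = {i', k'} \<and> i' \<in> {1..int (length w)} \<and>
          k' \<in> {1..int (length w)} \<and> i' \<noteq> k' \<and> \<bar>sp_app w i'\<bar> = k' \<and> \<bar>sp_app w k'\<bar> = i'"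
        by (intro exI[of _ "?g i"] exI[of _ "?g k"]) (auto simp: sp_app_Suc)
    qed
  qed
  moreover have "inj_on (image ?g) ?B" by (rule inj_on_image) (simp add: inj_on_def)
  ultimately show ?thesis
    unfolding cyc2_def by (simp only: card_image)
qed

lemma fixB_inv_word:
  assumes "a < b" "b < n" "e \<in> {1, -1}"
  shows "fixB (inv_word n a b e S) = n - 2"
proof -
  have "{k. k < n \<and> \<bar>inv_word n a b e S ! k\<bar> = int k + 1} = {..<n} - {a, b}"
    using assms by auto
  then show ?thesis using assms by (simp add: fixB_eq card_Diff_subset)
qed

lemma cyc2_inv_word:
  assumes "a < b" "b < n" "e \<in> {1, -1}"
  shows "cyc2 (inv_word n a b e S) = 1"
proof -
  let ?w = "inv_word n a b e S"
  have "i < k \<and> k < n \<and> \<bar>?w ! i\<bar> = int k + 1 \<and> \<bar>?w ! k\<bar> = int i + 1 \<longleftrightarrow> i = a \<and> k = b" for i k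
    using assms by (auto split: if_splits)
  then have "{{i, k} | i k. i < k \<and> k < n \<and> \<bar>?w ! i\<bar> = int k + 1 \<and> \<bar>?w ! k\<bar> = int i + 1}
             = {{a, b}}"
    by auto
  then show ?thesis by (simp add: cyc2_eq)
qed

section \<open>Every such involution arises from exactly one choice of parameters\<close>

lemma inv_word_exhaust:
  assumes w: "w \<in> signed_involutions (f + 2)" and "cyc2 w = 1" "fixB w = f"
  obtains a b e S where "a < b" "b < f + 2" "e \<in> {1, -1}" "S \<subseteq> {..<f + 2} - {a, b}"
    "w = inv_word (f + 2) a b e S"
proof -
  have len: "length w = f + 2"
    and inv: "\<And>i. i \<in> {- int (f + 2)..int (f + 2)} \<Longrightarrow> sp_app w (sp_app w i) = i"
    using w by (auto simp: signed_involutions_def signed_perms_def)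
  obtain x where x: "{{i, k} | i k. i < k \<and> k < length w \<and>
                    \<bar>w ! i\<bar> = int k + 1 \<and> \<bar>w ! k\<bar> = int i + 1} = {x}" (is "?B = _")
    using \<open>cyc2 w = 1\<close> unfolding cyc2_eq by (rule card_1_singletonE)
  have "x \<in> ?B" by (subst x) simp
  then obtain a b where ab: "a < b" "b < f + 2" "\<bar>w ! a\<bar> = int b + 1" "\<bar>w ! b\<bar> = int a + 1"
    using len by auto
  define Fx where "Fx = {k. k < length w \<and> \<bar>w ! k\<bar> = int k + 1}"
  \<comment> \<open>The fixed positions avoid \<open>a\<close> and \<open>b\<close>, and there are
    \<open>f\<close> of them, so they fill the complement.\<close>
  have "Fx = {..<f + 2} - {a, b}"
  proof (rule card_subset_eq)
    show "Fx \<subseteq> {..<f + 2} - {a, b}" using ab len by (auto simp: Fx_def)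
    show "card Fx = card ({..<f + 2} - {a, b})"
      using \<open>fixB w = f\<close> ab by (simp add: fixB_eq Fx_def card_Diff_subset)
  qed simp
  then have fx: "\<bar>w ! k\<bar> = int k + 1" if "k < f + 2" "k \<noteq> a" "k \<noteq> b" for k
    using that by (auto simp: Fx_def)
  define e where "e = sgn (w ! a)"
  have e: "e \<in> {1, -1}" and wa: "w ! a = e * (int b + 1)"
    using ab by (auto simp: e_def sgn_if)
  \<comment> \<open>The involution property at \<open>a + 1\<close> forces both letters of the cycle
    to carry the same sign \<open>e\<close>.\<close>
  have "sp_app w (sp_app w (int a + 1)) = int a + 1"
    using ab by (intro inv) auto
  then have "sp_app w (e * (int b + 1)) = int a + 1"
    by (simp only: sp_app_Suc wa)
  moreover have "sp_app w (e * (int b + 1)) = e * w ! b"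
    using e sp_app_minus[of w "int b + 1"] by (auto simp: sp_app_Suc)
  ultimately have wb: "w ! b = e * (int a + 1)" using e by auto
  define S where "S = {k. k < f + 2 \<and> w ! k < 0} - {a, b}"
  have "w = inv_word (f + 2) a b e S"
  proof (rule nth_equalityI)
    fix k assume "k < length w"
    then show "w ! k = inv_word (f + 2) a b e S ! k"
      using len wa wb fx[of k] by (auto simp: S_def)
  qed (simp add: len)
  moreover have "S \<subseteq> {..<f + 2} - {a, b}" by (auto simp: S_def)
  ultimately show ?thesis using ab(1,2) e by (intro that)
qed

text \<open>The positions moved in absolute value recover the cycle, and \<open>a < b\<close> orders
  them; the remaining data are signs of letters.\<close>

lemma inv_word_inject:
  assumes "a < b" "b < n" "e \<in> {1, -1}" "S \<subseteq> {..<n} - {a, b}"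
    and "a' < b'" "b' < n" "e' \<in> {1, -1}" "S' \<subseteq> {..<n} - {a', b'}"
    and eq: "inv_word n a b e S = inv_word n a' b' e' S'"
  shows "a = a' \<and> b = b' \<and> e = e' \<and> S = S'"
proof -
  have moved: "{k. k < n \<and> \<bar>inv_word n a b e S ! k\<bar> \<noteq> int k + 1} = {a, b}"
    if "a < b" "b < n" "e \<in> {1, -1}" for a b e S
    using that by (auto split: if_splits)
  have "{a, b} = {a', b'}"
    using moved[OF assms(1-3), of S] moved[OF assms(5-7), of S'] eq by simp
  with assms have ab: "a = a'" "b = b'" by (auto simp: doubleton_eq_iff)
  have nth: "inv_word n a b e S ! k = inv_word n a b e' S' ! k" for k
    using eq ab by simp
  have "e = e'" using nth[of a] \<open>a < b\<close> \<open>b < n\<close> by simp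
  moreover have "k \<in> S \<longleftrightarrow> k \<in> S'" for k
    using nth[of k] assms(4,8) ab by (cases "k < n") (auto split: if_splits)
  ultimately show ?thesis using ab by blast
qed

lemma bij_betw_inv_word:
  "bij_betw (\<lambda>(p, e, S). inv_word (f + 2) (fst p) (snd p) e S)
     (SIGMA p : {(a, b). a < b \<and> b < f + 2}. {1, -1} \<times> Pow ({..<f + 2} - {fst p, snd p}))
     {w \<in> signed_involutions (2 * 1 + f). cyc2 w = 1 \<and> fixB w = f}" (is "bij_betw ?h ?P ?W")
  unfolding bij_betw_def
proof
  show "inj_on ?h ?P"
  proof (rule inj_onI)
    fix x y assume xy: "x \<in> ?P" "y \<in> ?P" "?h x = ?h y"
    obtain a b e S where x: "x = ((a, b), e, S)" by (metis prod.exhaust)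
    obtain a' b' e' S' where y: "y = ((a', b'), e', S')" by (metis prod.exhaust)
    show "x = y"
      using inv_word_inject[of a b "f + 2" e S a' b' e' S'] xy unfolding x y by simp
  qed
  show "?h ` ?P = ?W"
  proof
    show "?h ` ?P \<subseteq> ?W"
      using inv_word_in_signed_involutions[of _ _ "f + 2"]
        cyc2_inv_word[of _ _ "f + 2"] fixB_inv_word[of _ _ "f + 2"]
      by (fastforce simp: add.commute)
    show "?W \<subseteq> ?h ` ?P"
    proof
      fix w assume "w \<in> ?W"
      then have "w \<in> signed_involutions (f + 2)" "cyc2 w = 1" "fixB w = f"
        by (auto simp: add.commute)
      then obtain a b e S where *: "a < b" "b < f + 2" "e \<in> {1, -1}"
        "S \<subseteq> {..<f + 2} - {a, b}" "w = inv_word (f + 2) a b e S"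
        by (rule inv_word_exhaust)
      then show "w \<in> ?h ` ?P"
        by (intro image_eqI[of _ _ "((a, b), e, S)"]) auto
    qed
  qed
qed

section \<open>Counting the pairs of cycle positions\<close>

lemma finite_pairs: "finite {(a, b). a < b \<and> b < (n::nat)}"
  by (rule finite_subset[of _ "{..<n} \<times> {..<n}"]) auto

text \<open>Each increase of \<open>f\<close> adds the new top position \<open>b = f + 2\<close>,
  with two choices of \<open>a\<close>.\<close>

lemma card_pairs_near: "card {(a, b). a < b \<and> b < f + 2 \<and> b \<le> a + 2} = 2 * f + 1"
proof (induction f)
  case 0
  have "{(a, b). a < b \<and> b < 0 + 2 \<and> b \<le> a + 2} = {(0, Suc 0)}" by auto
  then show ?case by simp
next
  case (Suc f)
  let ?A = "{(a, b). a < b \<and> b < f + 2 \<and> b \<le> a + 2}"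
  have "{(a, b). a < b \<and> b < Suc f + 2 \<and> b \<le> a + 2}
        = insert (f, f + 2) (insert (f + 1, f + 2) ?A)" by auto
  moreover have "finite ?A" by (rule finite_subset[OF _ finite_pairs[of "f + 2"]]) auto
  ultimately show ?case using Suc by simp
qed

text \<open>Here the new top position \<open>b = f + 2\<close> allows \<open>f\<close> choices of
  \<open>a\<close>, which matches Pascal's rule.\<close>

lemma card_pairs_far: "card {(a, b). a < b \<and> b < f + 2 \<and> \<not> b \<le> a + 2} = f choose 2"
proof (induction f)
  case 0
  have "{(a, b). a < b \<and> b < 0 + (2::nat) \<and> \<not> b \<le> a + 2} = {}" by auto
  then show ?case by (simp only: card.empty) simp
next
  case (Suc f)
  let ?A = "{(a, b). a < b \<and> b < f + 2 \<and> \<not> b \<le> a + 2}"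
  let ?B = "(\<lambda>a. (a, f + 2)) ` {..<f}"
  have "{(a, b). a < b \<and> b < Suc f + 2 \<and> \<not> b \<le> a + 2} = ?A \<union> ?B" by auto
  moreover have "finite ?A" by (rule finite_subset[OF _ finite_pairs[of "f + 2"]]) auto
  moreover have "?A \<inter> ?B = {}" by auto
  moreover have "card ?B = f" by (simp add: card_image inj_on_def)
  ultimately show ?case using Suc by (simp add: card_Un_disjoint numeral_2_eq_2)
qed

theorem corollary6p4:
  fixes f :: nat
  defines "t \<equiv> (monom 1 1 :: int poly)"
  shows "Fpoly 1 f =
           of_nat (2 * (2 * f + 1)) * t * (1 + t) ^ f
         + of_nat (8 * (f choose 2)) * t ^ 2 * (1 + t) ^ (f - 2)"
proof -
  define I where "I = {(a, b). a < b \<and> b < f + 2}"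
  define F where "F p = {..<f + 2} - {fst p, snd p}" for p :: "nat \<times> nat"
  define P where "P = t * (1 + t) ^ f"
  \<comment> \<open>For \<open>f < 2\<close> the exponent truncates to 0, but then \<open>Q\<close>
    is multiplied by \<open>f choose 2 = 0\<close>.\<close>
  define Q where "Q = 4 * t ^ 2 * (1 + t) ^ (f - 2)"
  have fin: "finite I" "finite (F p)" for p
    by (auto simp: I_def F_def finite_pairs)
  have "Fpoly 1 f = (\<Sum>(p, e, S)\<in>(SIGMA p : I. {1, -1} \<times> Pow (F p)).
                       monom 1 (desB (inv_word (f + 2) (fst p) (snd p) e S)))"
    unfolding Fpoly_def I_def F_def
    by (subst sum.reindex_bij_betw[OF bij_betw_inv_word, symmetric]) (simp add: case_prod_unfold)
  also have "\<dots> = (\<Sum>p\<in>I. \<Sum>e\<in>{1, -1}. \<Sum>S\<in>Pow (F p).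
                       monom 1 (desB (inv_word (f + 2) (fst p) (snd p) e S)))"
    by (subst sum.Sigma[symmetric]) (simp_all only: fin sum.cartesian_product, simp add: fin)
  also have "\<dots> = (\<Sum>p\<in>I. \<Sum>e\<in>{1, -1::int}. if snd p \<le> fst p + 2 then P else Q)"
    unfolding F_def P_def Q_def t_def
    by (intro sum.cong refl sum_desB_inv_word) (auto simp: I_def)
  \<comment> \<open>The summand does not depend on the sign \<open>e\<close>.\<close>
  also have "\<dots> = 2 * (\<Sum>p\<in>I. if snd p \<le> fst p + 2 then P else Q)"
    by (simp add: sum_distrib_left)
  also have "(\<Sum>p\<in>I. if snd p \<le> fst p + 2 then P else Q)
      = of_nat (card (I \<inter> {p. snd p \<le> fst p + 2})) * P
        + of_nat (card (I \<inter> - {p. snd p \<le> fst p + 2})) * Q"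
    using fin by (simp add: sum.If_cases)
  also have "I \<inter> {p. snd p \<le> fst p + 2} = {(a, b). a < b \<and> b < f + 2 \<and> b \<le> a + 2}"
    by (auto simp: I_def)
  also have "I \<inter> - {p. snd p \<le> fst p + 2} = {(a, b). a < b \<and> b < f + 2 \<and> \<not> b \<le> a + 2}"
    by (auto simp: I_def)
  finally show ?thesis
    unfolding card_pairs_near card_pairs_far P_def Q_def
    by (simp add: algebra_simps)
qed

end
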